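(* Let $A\in\mathbb{R}^{m\times n}$, $L\in\mathbb{R}^{p\times n}$ with $\mathrm{rank}((A^{\top},L^{\top})^{\top})=r$, let $M=A^{\top}A+L^{\top}L$, and let $A=P_AC_AX^{-1}$, $L=P_LS_LX^{-1}$ be a GSVD of $\{A,L\}$ (in the form given in the context), with $P_A=(p_{A,1},\dots,p_{A,m})$. Let $b\in\mathbb{R}^m$ be nonzero, and run the gGKB process of the operator $\mathcal{A}:(\mathcal{R}(M),\langle\cdot,\cdot\rangle_M)\to(\mathbb{R}^m,\langle\cdot,\cdot\rangle_2)$, $v\mapsto Av$, with starting vector $b$ (described in the context). Suppose there are exactly $l$ distinct positive values among the $c_i$ appearing on the diagonal of $\Sigma_A$, and let $\mathcal{G}_1,\dots,\mathcal{G}_l\subseteq\mathbb{R}^m$ be the $l$ subspaces, each spanned by the vectors $p_{A,i}$ corresponding to one of these distinct positive values. Then the terminate step $$k_t=\min\{k\ge 0:\ \alpha_{k+1}\beta_{k+1}=0\}$$ equals the number of nonzero elements in $\{\mathcal{P}_{\mathcal{G}_1}b,\dots,\mathcal{P}_{\mathcal{G}_l}b\}$, i.e. the number of indices $j\in\{1,\dots,l\}$ with $\mathcal{P}_{\mathcal{G}_j}b\ne\mathbf{0}$.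
   Context: $\mathcal{P}_{\mathcal{G}}$ is the Euclidean orthogonal projection onto $\mathcal{G}$; $\mathcal{R}(\cdot)$ is the column space; $M^{\dag}$ is the Moore-Penrose pseudoinverse; $\|v\|_M=(v^{\top}Mv)^{1/2}$, which is a norm on $\mathcal{R}(M)$. gGKB process (generalized Golub-Kahan bidiagonalization, Euclidean inner product on $\mathbb{R}^m$): $v_0=\mathbf{0}$, $\beta_1u_1=b$, and for $i\ge1$ $$\alpha_iv_i=M^{\dag}A^{\top}u_i-\beta_iv_{i-1},\qquad \beta_{i+1}u_{i+1}=Av_i-\alpha_iu_i,$$ where $\alpha_i\ge0,\beta_i\ge0$ are chosen so that $\|v_i\|_M=\|u_i\|_2=1$, i.e. $\alpha_i$ (resp. $\beta_{i+1}$) is the $M$-norm (resp. 2-norm) of the right-hand side and the vector is obtained by normalizing. The process stops as soon as some $\alpha_i$ or $\beta_i$ equals zero (subsequent coefficients are taken to be zero). GSVD: a pair of factorizations $A=P_AC_AX^{-1}$, $L=P_LS_LX^{-1}$ with $P_A\in\mathbb{R}^{m\times m}$, $P_L\in\mathbb{R}^{p\times p}$ orthogonal, $X\in\mathbb{R}^{n\times n}$ invertible, $C_A=(\Sigma_A\ \ \mathbf{0})\in\mathbb{R}^{m\times n}$, $S_L=(\Sigma_L\ \ \mathbf{0})\in\mathbb{R}^{p\times n}$ (the zero blocks having $n-r$ columns), where $\Sigma_A\in\mathbb{R}^{m\times r}$ and $\Sigma_L\in\mathbb{R}^{p\times r}$ are block diagonal with (possibly rectangular or empty) diagonal blocks $$\Sigma_A:\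 I_{q_1},\ C_{q_2},\ \mathbf{0}_{(m-q_1-q_2)\times q_3};\qquad \Sigma_L:\ \mathbf{0}_{(p-r+q_1)\times q_1},\ S_{q_2},\ I_{q_3},$$ with $q_1+q_2+q_3=r$, $C_{q_2}=\mathrm{diag}(c_{q_1+1},\dots,c_{q_1+q_2})$, $1>c_{q_1+1}\ge\cdots\ge c_{q_1+q_2}>0$, $S_{q_2}=\mathrm{diag}(s_{q_1+1},\dots,s_{q_1+q_2})$, $0<s_{q_1+1}\le\cdots\le s_{q_1+q_2}<1$, and $\Sigma_A^{\top}\Sigma_A+\Sigma_L^{\top}\Sigma_L=I_r$. Also $c_1=\cdots=c_{q_1}=1$ and $c_{q_1+q_2+1}=\cdots=c_r=0$; the vector $p_{A,i}$ ($1\le i\le q_1+q_2$) corresponds to the positive value $c_i$. *)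

theory Defs
  imports Complex_Main "Jordan_Normal_Form.DL_Rank"
begin

text \<open>
  Matrices and vectors are those of \<^theory>\<open>Jordan_Normal_Form.Matrix\<close>, indexed from 0. Hence the
  paper's $p_{A,i}$, $c_i$, $s_i$ are \<open>col PA (i - 1)\<close>, \<open>c (i - 1)\<close>, \<open>s (i - 1)\<close> below. The gGKB
  quantities $\alpha_i, \beta_i, u_i, v_i$ keep the paper's indices.
\<close>

definition norm2 :: "real vec \<Rightarrow> real" where
  "norm2 v = sqrt (v \<bullet> v)"

definition mnorm :: "real mat \<Rightarrow> real vec \<Rightarrow> real" where
  "mnorm M v = sqrt (v \<bullet> (M *\<^sub>v v))"

definition pinv :: "real mat \<Rightarrow> real mat" where
  "pinv M = (THE N. N \<in> carrier_mat (dim_col M) (dim_row M) \<and>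
     M * N * M = M \<and> N * M * N = N \<and> (M * N)\<^sup>T = M * N \<and> (N * M)\<^sup>T = N * M)"

definition vspan :: "nat \<Rightarrow> real vec set \<Rightarrow> real vec set" where
  "vspan m S = LinearCombinations.module.span class_ring (module_vec TYPE(real) m) S"

definition orth_proj :: "nat \<Rightarrow> real vec set \<Rightarrow> real vec \<Rightarrow> real vec" where
  "orth_proj m G x = (THE w. w \<in> G \<and> w \<in> carrier_vec m \<and> (\<forall>g\<in>G. (x - w) \<bullet> g = 0))"

text \<open>
  \<open>ggkb A M b i\<close> is the quadruple $(\alpha_i, v_i, \beta_{i+1}, u_{i+1})$; the first component for
  $i = 0$ is a dummy. After a breakdown, \<open>1 / 0 = 0\<close> turns the vector that cannot be normalized into
  the zero vector, and then all later coefficients are zero as well.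
\<close>

fun ggkb :: "real mat \<Rightarrow> real mat \<Rightarrow> real vec \<Rightarrow> nat \<Rightarrow> real \<times> real vec \<times> real \<times> real vec" where
  "ggkb A M b 0 = (0, 0\<^sub>v (dim_col A), norm2 b, (1 / norm2 b) \<cdot>\<^sub>v b)"
| "ggkb A M b (Suc i) =
    (let (_, v, \<beta>, u) = ggkb A M b i;
         w = (pinv M * A\<^sup>T) *\<^sub>v u - \<beta> \<cdot>\<^sub>v v;
         \<alpha> = mnorm M w;
         v' = (1 / \<alpha>) \<cdot>\<^sub>v w;
         z = A *\<^sub>v v' - \<alpha> \<cdot>\<^sub>v u;
         \<beta>' = norm2 z
     in (\<alpha>, v', \<beta>', (1 / \<beta>') \<cdot>\<^sub>v z))"

text \<open>Both are meant for \<open>i \<ge> 1\<close>.\<close>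

definition ggkb_alpha :: "real mat \<Rightarrow> real mat \<Rightarrow> real vec \<Rightarrow> nat \<Rightarrow> real" where
  "ggkb_alpha A M b i = fst (ggkb A M b i)"

definition ggkb_beta :: "real mat \<Rightarrow> real mat \<Rightarrow> real vec \<Rightarrow> nat \<Rightarrow> real" where
  "ggkb_beta A M b i = fst (snd (snd (ggkb A M b (i - 1))))"

definition Sigma_A :: "nat \<Rightarrow> nat \<Rightarrow> nat \<Rightarrow> nat \<Rightarrow> (nat \<Rightarrow> real) \<Rightarrow> real mat" where
  "Sigma_A m q1 q2 q3 c =
     diag_block_mat [1\<^sub>m q1, mat_diag q2 (\<lambda>i. c (q1 + i)), 0\<^sub>m (m - q1 - q2) q3]"

text \<open>The zero block has $p - r + q_1 = p - q_2 - q_3$ rows.\<close>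

definition Sigma_L :: "nat \<Rightarrow> nat \<Rightarrow> nat \<Rightarrow> nat \<Rightarrow> (nat \<Rightarrow> real) \<Rightarrow> real mat" where
  "Sigma_L p q1 q2 q3 s =
     diag_block_mat [0\<^sub>m (p - q2 - q3) q1, mat_diag q2 (\<lambda>i. s (q1 + i)), 1\<^sub>m q3]"

definition append_zero_cols :: "real mat \<Rightarrow> nat \<Rightarrow> real mat" where
  "append_zero_cols S k =
     four_block_mat S (0\<^sub>m (dim_row S) k) (0\<^sub>m 0 (dim_col S)) (0\<^sub>m 0 k)"

text \<open>
  The conditions \<open>q1 + q2 \<le> m\<close>, \<open>q2 + q3 \<le> p\<close> and \<open>r \<le> n\<close> say that the block sizes
  $m - q_1 - q_2$, $p - r + q_1$ and $n - r$, computed here with truncated subtraction, make sense.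
\<close>

definition is_gsvd ::
  "nat \<Rightarrow> nat \<Rightarrow> nat \<Rightarrow> nat \<Rightarrow> nat \<Rightarrow> nat \<Rightarrow> nat \<Rightarrow> (nat \<Rightarrow> real) \<Rightarrow> (nat \<Rightarrow> real) \<Rightarrow>
   real mat \<Rightarrow> real mat \<Rightarrow> real mat \<Rightarrow> real mat \<Rightarrow> real mat \<Rightarrow> bool" where
  "is_gsvd m p n r q1 q2 q3 c s PA PL X A L \<longleftrightarrow>
     q1 + q2 + q3 = r \<and> q1 + q2 \<le> m \<and> q2 + q3 \<le> p \<and> r \<le> n \<and>
     PA \<in> carrier_mat m m \<and> PA\<^sup>T * PA = 1\<^sub>m m \<and>
     PL \<in> carrier_mat p p \<and> PL\<^sup>T * PL = 1\<^sub>m p \<and>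
     X \<in> carrier_mat n n \<and>
     (\<exists>Y \<in> carrier_mat n n. inverts_mat X Y \<and> inverts_mat Y X \<and>
        A = PA * append_zero_cols (Sigma_A m q1 q2 q3 c) (n - r) * Y \<and>
        L = PL * append_zero_cols (Sigma_L p q1 q2 q3 s) (n - r) * Y) \<and>
     (\<forall>i<q1. c i = 1) \<and>
     (\<forall>i\<in>{q1..<q1 + q2}. 0 < c i \<and> c i < 1 \<and> 0 < s i \<and> s i < 1) \<and>
     (\<forall>i\<in>{q1..<q1 + q2}. \<forall>j\<in>{q1..<q1 + q2}. i \<le> j \<longrightarrow> c j \<le> c i \<and> s i \<le> s j) \<and>
     (\<forall>i\<in>{q1 + q2..<r}. c i = 0) \<and>
     (Sigma_A m q1 q2 q3 c)\<^sup>T * Sigma_A m q1 q2 q3 c +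
       (Sigma_L p q1 q2 q3 s)\<^sup>T * Sigma_L p q1 q2 q3 s = 1\<^sub>m r"

end

(* In the bases given by the GSVD, the operator and its adjoint act diagonally, with the values c_i.
   With y = P_A^T b, the gGKB vectors therefore have coordinates p(c_i^2) y_i and c_i q(c_i^2) y_i,
   where the polynomials p, q follow a Golub-Kahan recursion; before a breakdown their degrees
   increase by one in each step, and they are orthonormal with respect to the discrete measures with
   masses y_i^2 and c_i^2 y_i^2 at the nodes c_i^2. A breakdown at step k produces a nonzero
   polynomial of degree at most k that vanishes at all positive nodes of nonzero mass, so k is at
   least their number K; conversely, a normalized polynomial of degree K cannot be orthogonal to all
   polynomials of lower degree, since modulo the node polynomial it has degree less than K. Finally,
   a node carries mass iff the projection of b on the corresponding space is nonzero. *)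

theory Submission
  imports Defs "HOL-Computational_Algebra.Polynomial"
begin

section \<open>Golub-Kahan recursion for polynomials under a discrete measure\<close>

abbreviation (input) smult :: "real \<Rightarrow> real poly \<Rightarrow> real poly" where
  "smult \<equiv> Polynomial.smult"

text \<open>The bilinear form of the discrete measure with masses \<open>w i\<close> at
  \<open>x i\<close>. Repeated nodes and zero masses are allowed, and for \<open>w \<ge> 0\<close>
  the form is only semidefinite on polynomials.\<close>

definition poly_form :: "nat \<Rightarrow> (nat \<Rightarrow> real) \<Rightarrow> (nat \<Rightarrow> real) \<Rightarrow> real poly \<Rightarrow> real poly \<Rightarrow> real" where
  "poly_form m w x P Q = (\<Sum>i<m. w i * poly P (x i) * poly Q (x i))"

text \<open>Mirrors \<open>ggkb\<close> component by component, so the third entry at index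
  \<open>i\<close> is \<beta> with index \<open>i + 1\<close>. One factor c_i of the v-coordinates
  is kept outside \<open>Q\<close>; this is why the norm of \<open>W\<close> carries an extra
  variable and why \<open>A\<close> becomes multiplication by the variable. As in
  \<open>ggkb\<close>, \<open>1 / 0 = 0\<close> governs the steps after a breakdown.\<close>

fun gk_poly :: "nat \<Rightarrow> (nat \<Rightarrow> real) \<Rightarrow> (nat \<Rightarrow> real) \<Rightarrow> nat \<Rightarrow> real \<times> real poly \<times> real \<times> real poly" where
  "gk_poly m w x 0 =
    (let \<beta> = sqrt (poly_form m w x 1 1) in (0, 0, \<beta>, smult (1 / \<beta>) 1))"
| "gk_poly m w x (Suc i) =
    (let (_, Q, \<beta>, P) = gk_poly m w x i;
         W = P - smult \<beta> Q;
         \<alpha> = sqrt (poly_form m w x W (pCons 0 W));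
         Q' = smult (1 / \<alpha>) W;
         Z = pCons 0 Q' - smult \<alpha> P;
         \<beta>' = sqrt (poly_form m w x Z Z)
     in (\<alpha>, Q', \<beta>', smult (1 / \<beta>') Z))"

lemma poly_form_commute: "poly_form m w x P Q = poly_form m w x Q P"
  by (simp add: poly_form_def mult_ac)

lemma poly_form_diff_left:
  "poly_form m w x (P - P') Q = poly_form m w x P Q - poly_form m w x P' Q"
  by (simp add: poly_form_def algebra_simps sum_subtractf)

lemma poly_form_add_left:
  "poly_form m w x (P + P') Q = poly_form m w x P Q + poly_form m w x P' Q"
  by (simp add: poly_form_def algebra_simps sum.distrib)

lemma poly_form_smult_left: "poly_form m w x (smult a P) Q = a * poly_form m w x P Q"
  by (simp add: poly_form_def algebra_simps sum_distrib_left)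

lemma poly_form_pCons_left: "poly_form m w x (pCons 0 P) Q = poly_form m w x P (pCons 0 Q)"
  by (simp add: poly_form_def algebra_simps)

text \<open>One step of polynomial division. The alternative \<open>T = 0\<close> covers constants,
  whose degree cannot drop any further.\<close>

lemma degree_cancel_lead:
  fixes R S :: "real poly"
  assumes "S \<noteq> 0" "degree R = degree S"
  defines "T \<equiv> R - smult (lead_coeff R / lead_coeff S) S"
  shows "degree T < degree S \<or> T = 0"
proof -
  have "degree T \<le> degree S"
    unfolding T_def using assms(2) by (intro degree_diff_le degree_smult_le) simp
  moreover have "coeff T (degree S) = 0"
    using assms by (simp add: T_def)
  ultimately show ?thesis by (metis leading_coeff_0_iff le_neq_implies_less)
qed

lemma degree_diff_eq_left: "degree R' < degree R \<Longrightarrow> degree (R - R') = degree R"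
  for R R' :: "real poly"
  by (metis degree_add_eq_left degree_minus diff_conv_add_uminus)

locale gk_polynomials =
  fixes m :: nat and w x :: "nat \<Rightarrow> real"
  assumes w_nonneg: "i < m \<Longrightarrow> 0 \<le> w i" and x_nonneg: "i < m \<Longrightarrow> 0 \<le> x i"
    and w_nonzero: "\<exists>i<m. w i \<noteq> 0"
begin

abbreviation "alpha i \<equiv> fst (gk_poly m w x i)"
abbreviation "Q i \<equiv> fst (snd (gk_poly m w x i))"
abbreviation "beta i \<equiv> fst (snd (snd (gk_poly m w x i)))"
abbreviation "P i \<equiv> snd (snd (snd (gk_poly m w x i)))"

abbreviation "uform \<equiv> poly_form m w x"
text \<open>The form of the measure with masses \<open>w i * x i\<close>, on the side of the vectors
  v_i.\<close>

abbreviation "vform R S \<equiv> poly_form m w x R (pCons 0 S)"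

abbreviation "W i \<equiv> P i - smult (beta i) (Q i)"
abbreviation "Z i \<equiv> pCons 0 (Q (Suc i)) - smult (alpha (Suc i)) (P i)"

lemma alpha_Suc: "alpha (Suc i) = sqrt (vform (W i) (W i))"
  and Q_Suc: "Q (Suc i) = smult (1 / alpha (Suc i)) (W i)"
  and beta_Suc: "beta (Suc i) = sqrt (uform (Z i) (Z i))"
  and P_Suc: "P (Suc i) = smult (1 / beta (Suc i)) (Z i)"
  by (simp_all add: Let_def case_prod_unfold)

lemma beta_0: "beta 0 = sqrt (uform 1 1)" and P_0: "P 0 = smult (1 / beta 0) 1" and Q_0: "Q 0 = 0"
  by (simp_all add: Let_def)

declare gk_poly.simps [simp del]

lemma uform_nonneg: "0 \<le> uform R R"
  unfolding poly_form_def mult.assoc by (intro sum_nonneg mult_nonneg_nonneg[of "w _"]) (auto simp: w_nonneg)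

lemma vform_nonneg: "0 \<le> vform R R"
proof -
  have "vform R R = (\<Sum>i<m. w i * x i * (poly R (x i))\<^sup>2)"
    by (simp add: poly_form_def power2_eq_square algebra_simps)
  then show ?thesis by (auto intro!: sum_nonneg simp: w_nonneg x_nonneg)
qed

lemma uform_eq_0_iff: "uform R R = 0 \<longleftrightarrow> (\<forall>i<m. w i \<noteq> 0 \<longrightarrow> poly R (x i) = 0)"
proof -
  have "uform R R = (\<Sum>i<m. w i * (poly R (x i))\<^sup>2)"
    by (simp add: poly_form_def power2_eq_square algebra_simps)
  also have "\<dots> = 0 \<longleftrightarrow> (\<forall>i\<in>{..<m}. w i * (poly R (x i))\<^sup>2 = 0)"
    by (intro sum_nonneg_eq_0_iff) (auto simp: w_nonneg)
  finally show ?thesis by auto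
qed

text \<open>The extra factor \<open>x i\<close> removes the mass at the node 0; this is how only
  positive values come to be counted.\<close>

lemma vform_eq_0_iff: "vform R R = 0 \<longleftrightarrow> (\<forall>i<m. w i \<noteq> 0 \<and> 0 < x i \<longrightarrow> poly R (x i) = 0)"
proof -
  have "vform R R = (\<Sum>i<m. w i * x i * (poly R (x i))\<^sup>2)"
    by (simp add: poly_form_def power2_eq_square algebra_simps)
  also have "\<dots> = 0 \<longleftrightarrow> (\<forall>i\<in>{..<m}. w i * x i * (poly R (x i))\<^sup>2 = 0)"
    by (intro sum_nonneg_eq_0_iff) (auto simp: w_nonneg x_nonneg)
  finally show ?thesis using x_nonneg by (force simp: less_le)
qed

lemma beta_0_pos: "0 < beta 0"
  using uform_eq_0_iff[of 1] uform_nonneg[of 1] w_nonzero by (auto simp: beta_0 less_le)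

lemma vform_commute: "vform R S = vform S R"
  by (metis poly_form_commute poly_form_pCons_left)

section \<open>Degrees before a breakdown\<close>

text \<open>In the indices of the process, \<alpha>_1, ..., \<alpha>_k and \<beta>_2, ...,
  \<beta>_{k+1} are nonzero; \<beta>_1 is \<open>beta 0\<close>, which is positive by
  \<open>beta_0_pos\<close>.\<close>

definition unbroken :: "nat \<Rightarrow> bool" where
  "unbroken k \<longleftrightarrow> (\<forall>i<k. alpha (Suc i) \<noteq> 0 \<and> beta (Suc i) \<noteq> 0)"

lemma unbroken_Suc: "unbroken (Suc n) \<longleftrightarrow> unbroken n \<and> alpha (Suc n) \<noteq> 0 \<and> beta (Suc n) \<noteq> 0"
  unfolding unbroken_def using less_Suc_eq by auto

text \<open>For \<open>k > 0\<close> the subtracted multiple of \<open>Q k\<close> has smaller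
  degree than \<open>P k\<close> and leaves the leading term alone; for \<open>k = 0\<close> it is
  zero.\<close>

lemma degree_W_step:
  assumes "P k \<noteq> 0" "degree (P k) = k" "k > 0 \<Longrightarrow> degree (Q k) = k - 1"
  shows "W k \<noteq> 0 \<and> degree (W k) = k"
proof (cases "k = 0")
  case False
  then have "degree (smult (beta k) (Q k)) < degree (P k)"
    using assms le_less_trans[OF degree_smult_le] by simp
  then show ?thesis using assms False by (metis degree_0 degree_diff_eq_left)
qed (use assms in \<open>simp add: Q_0\<close>)

text \<open>Multiplying \<open>Q (Suc k)\<close> by the variable lifts its degree to
  \<open>k + 1\<close>, above that of \<open>P k\<close>.\<close>

lemma degree_Z_step:
  assumes "degree (P k) = k" "W k \<noteq> 0" "degree (W k) = k" "alpha (Suc k) \<noteq> 0"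
  shows "degree (Z k) = Suc k"
proof -
  have Q: "Q (Suc k) \<noteq> 0" "degree (Q (Suc k)) = k"
    using assms by (simp_all add: Q_Suc)
  then have "degree (smult (alpha (Suc k)) (P k)) < degree (pCons 0 (Q (Suc k)))"
    using assms by simp
  then have "degree (Z k) = degree (pCons 0 (Q (Suc k)))" by (rule degree_diff_eq_left)
  then show ?thesis using Q by simp
qed

text \<open>Index shift: \<open>Q i\<close> has degree \<open>i - 1\<close>, and \<open>Q 0\<close> is zero.\<close>

lemma degree_PQ:
  "unbroken k \<Longrightarrow> P k \<noteq> 0 \<and> degree (P k) = k \<and> (k > 0 \<longrightarrow> degree (Q k) = k - 1)"
proof (induction k)
  case 0
  then show ?case using beta_0_pos by (simp add: P_0)
next
  case (Suc k)
  then have IH: "P k \<noteq> 0" "degree (P k) = k" "k > 0 \<Longrightarrow> degree (Q k) = k - 1"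
    and nz: "alpha (Suc k) \<noteq> 0" "beta (Suc k) \<noteq> 0"
    by (auto simp: unbroken_Suc)
  note W = degree_W_step[OF IH]
  have Z: "degree (Z k) = Suc k" using degree_Z_step IH(2) W nz(1) by blast
  then have "Z k \<noteq> 0" by (metis degree_0 nat.distinct(1))
  with Z have "P (Suc k) \<noteq> 0" "degree (P (Suc k)) = Suc k"
    unfolding P_Suc using nz(2) by (simp_all del: poly_diff)
  moreover have "degree (Q (Suc k)) = k" unfolding Q_Suc using W nz(1) by simp
  ultimately show ?case by simp
qed

lemma degree_W:
  assumes "unbroken k"
  shows "W k \<noteq> 0" "degree (W k) = k"
  using degree_W_step[of k] degree_PQ[OF assms] by auto

lemma degree_Z:
  assumes "unbroken k" "alpha (Suc k) \<noteq> 0"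
  shows "degree (Z k) = Suc k"
  using degree_Z_step[OF _ degree_W[OF assms(1)] assms(2)] degree_PQ[OF assms(1)] by blast

section \<open>Orthogonality of the two polynomial families\<close>

text \<open>This and the next lemma are the recurrences solved for the older term. They trade
  products with \<open>P\<close> for products with \<open>Q\<close> and conversely.\<close>

lemma P_expand: "alpha (Suc i) \<noteq> 0 \<Longrightarrow> P i = smult (alpha (Suc i)) (Q (Suc i)) + smult (beta i) (Q i)"
  by (simp add: Q_Suc)

lemma pCons_Q_expand:
  "beta (Suc i) \<noteq> 0 \<Longrightarrow> pCons 0 (Q (Suc i)) = smult (beta (Suc i)) (P (Suc i)) + smult (alpha (Suc i)) (P i)"
  by (simp add: P_Suc)

lemma vform_Q_self:
  assumes "alpha (Suc n) \<noteq> 0"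
  shows "vform (Q (Suc n)) (Q (Suc n)) = 1"
proof -
  have "vform (Q (Suc n)) (Q (Suc n)) = (1 / alpha (Suc n)) * ((1 / alpha (Suc n)) * vform (W n) (W n))"
    by (metis Q_Suc poly_form_smult_left vform_commute)
  moreover have "vform (W n) (W n) = (alpha (Suc n))\<^sup>2"
    by (simp add: alpha_Suc vform_nonneg)
  ultimately show ?thesis using assms by (simp add: power2_eq_square)
qed

lemma uform_P_self:
  assumes "beta n \<noteq> 0"
  shows "uform (P n) (P n) = 1"
proof -
  \<comment> \<open>\<open>R\<close> is the polynomial before normalization: \<open>1\<close> for
    \<open>n = 0\<close> and \<open>Z (n - 1)\<close> otherwise.\<close>
  obtain R where R: "P n = smult (1 / beta n) R" "beta n = sqrt (uform R R)"
    by (cases n) (metis beta_0 P_0, metis beta_Suc P_Suc)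
  have "uform (P n) (P n) = (1 / beta n) * ((1 / beta n) * uform R R)"
    by (metis R(1) poly_form_smult_left poly_form_commute)
  moreover have "uform R R = (beta n)\<^sup>2"
    by (simp add: R(2) uform_nonneg)
  ultimately show ?thesis using assms by (simp add: power2_eq_square)
qed

text \<open>The product of \<open>W n\<close> with \<open>Q (Suc j)\<close> is a
  \<open>uform\<close> product of \<open>P n\<close> with \<open>pCons 0 (Q (Suc j))\<close> minus
  \<open>beta n\<close> times a \<open>vform\<close> product of \<open>Q n\<close>. Expanding the
  shifted polynomial in \<open>P (Suc j)\<close> and \<open>P j\<close> leaves zero terms, except
  for \<open>Suc j = n\<close>, where both sides equal \<open>beta n\<close> and cancel.\<close>

lemma vform_Q_step:
  assumes "unbroken n" "alpha (Suc n) \<noteq> 0"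
    and P: "\<And>j. j < n \<Longrightarrow> uform (P n) (P j) = 0"
    and Q: "\<And>j. Suc j < n \<Longrightarrow> vform (Q n) (Q (Suc j)) = 0"
    and "j < n"
  shows "vform (Q (Suc n)) (Q (Suc j)) = 0"
proof -
  have nz: "beta (Suc j) \<noteq> 0" "alpha n \<noteq> 0" "beta n \<noteq> 0"
    using assms(1) \<open>j < n\<close> unfolding unbroken_def by (cases n; auto)+
  have "uform (P n) (pCons 0 (Q (Suc j))) = beta (Suc j) * uform (P n) (P (Suc j))"
    using P[OF \<open>j < n\<close>]
    by (simp add: pCons_Q_expand[OF nz(1)] poly_form_commute[of m w x "P n"] poly_form_add_left poly_form_smult_left)
  moreover have "beta (Suc j) * uform (P n) (P (Suc j)) = beta n * vform (Q n) (Q (Suc j))"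
  proof (cases "Suc j = n")
    case True
    then show ?thesis using nz uform_P_self[of n] vform_Q_self[of j] by simp
  next
    case False
    then show ?thesis using \<open>j < n\<close> P[of "Suc j"] Q[of j] by simp
  qed
  ultimately have "vform (W n) (Q (Suc j)) = 0"
    by (simp add: poly_form_diff_left poly_form_smult_left)
  then show ?thesis by (simp only: Q_Suc[of n] poly_form_smult_left)
qed

text \<open>The dual step: the variable moves across the form, \<open>P j\<close> is expanded in
  \<open>Q (Suc j)\<close> and \<open>Q j\<close>, and for \<open>j = n\<close> the two remaining
  terms both equal \<open>alpha (Suc n)\<close>.\<close>

lemma uform_P_step:
  assumes "unbroken n" "alpha (Suc n) \<noteq> 0"
    and P: "\<And>j. j < n \<Longrightarrow> uform (P n) (P j) = 0"
    and Q: "\<And>j. j < n \<Longrightarrow> vform (Q (Suc n)) (Q (Suc j)) = 0"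
    and "j \<le> n"
  shows "uform (P (Suc n)) (P j) = 0"
proof -
  have nz: "alpha (Suc j) \<noteq> 0" "beta n \<noteq> 0"
    using assms(1,2) \<open>j \<le> n\<close> beta_0_pos unfolding unbroken_def
    by (metis le_neq_implies_less less_irrefl lessI not0_implies_Suc)+
  have "vform (Q (Suc n)) (Q j) = 0"
    using \<open>j \<le> n\<close> Q by (cases j) (auto simp: Q_0 poly_form_def)
  then have "vform (Q (Suc n)) (P j) = alpha (Suc j) * vform (Q (Suc n)) (Q (Suc j))"
    by (simp add: P_expand[OF nz(1)] vform_commute[of "Q (Suc n)"] poly_form_add_left poly_form_smult_left)
  also have "\<dots> = alpha (Suc n) * uform (P n) (P j)"
  proof (cases "j = n")
    case True
    then show ?thesis using vform_Q_self[OF assms(2)] uform_P_self[OF nz(2)] by simp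
  next
    case False
    then show ?thesis using \<open>j \<le> n\<close> P[of j] Q[of j] by simp
  qed
  finally have "uform (Z n) (P j) = 0"
    by (simp add: poly_form_diff_left poly_form_smult_left poly_form_pCons_left)
  then show ?thesis by (simp only: P_Suc[of n] poly_form_smult_left)
qed

text \<open>Both families go through one induction, since \<open>Q (Suc n)\<close> needs the
  orthogonality of \<open>P n\<close>, and \<open>P (Suc n)\<close> needs that of
  \<open>Q (Suc n)\<close>.\<close>

lemma gk_orthogonal:
  assumes "unbroken n"
  shows "(\<forall>j<n. uform (P n) (P j) = 0) \<and> (\<forall>j. Suc j < n \<longrightarrow> vform (Q n) (Q (Suc j)) = 0)"
  using assms
proof (induction n)
  case (Suc n)
  then have n: "unbroken n" "alpha (Suc n) \<noteq> 0" by (auto simp: unbroken_Suc)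
  note IH = Suc.IH[OF n(1)]
  have "\<forall>j<n. vform (Q (Suc n)) (Q (Suc j)) = 0"
    using vform_Q_step[OF n] IH by blast
  moreover from this have "\<forall>j\<le>n. uform (P (Suc n)) (P j) = 0"
    using uform_P_step[OF n] IH by blast
  ultimately show ?case by auto
qed auto

text \<open>\<open>Q 1\<close>, ..., \<open>Q d\<close> have degrees 0, ..., d - 1 and hence span
  the polynomials of degree below \<open>d\<close>. The induction on \<open>d\<close> removes one
  leading term at a time; for \<open>d = 0\<close> only \<open>R = 0\<close> is left.\<close>

lemma vform_Q_low_degree:
  assumes "unbroken n" "alpha (Suc n) \<noteq> 0" "d \<le> n" "degree R < d \<or> R = 0"
  shows "vform (Q (Suc n)) R = 0"
  using assms(3,4)
proof (induction d arbitrary: R)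
  case (Suc d)
  show ?case
  proof (cases "R = 0 \<or> degree R < d")
    case True
    then show ?thesis using Suc by auto
  next
    case False
    then have R: "R \<noteq> 0" "degree R = d" using Suc.prems by auto
    have "unbroken d" "alpha (Suc d) \<noteq> 0"
      using assms(1) Suc.prems by (auto simp: unbroken_def)
    then have Qd: "Q (Suc d) \<noteq> 0" "degree (Q (Suc d)) = d"
      using degree_W[of d] by (simp_all add: Q_Suc)
    define a where "a = lead_coeff R / lead_coeff (Q (Suc d))"
    define R' where "R' = R - smult a (Q (Suc d))"
    have "degree R' < d \<or> R' = 0"
      unfolding R'_def a_def using degree_cancel_lead[of "Q (Suc d)" R] R Qd by simp
    then have "vform (Q (Suc n)) R' = 0" using Suc by auto
    moreover have "vform (Q (Suc n)) (Q (Suc d)) = 0"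
      using vform_Q_step[OF assms(1,2)] gk_orthogonal[OF assms(1)] Suc.prems by auto
    moreover have "R = R' + smult a (Q (Suc d))" by (simp add: R'_def)
    ultimately show ?thesis
      by (metis (no_types) add_0 mult_zero_right poly_form_add_left poly_form_smult_left vform_commute)
  qed
qed (auto simp: poly_form_def)

section \<open>Positive nodes and the index of the breakdown\<close>

text \<open>The support of the measure of \<open>vform\<close>. Being a set, it merges indices with
  equal \<open>x i\<close>, so that its cardinality counts distinct values.\<close>

definition nodes :: "real set" where
  "nodes = {x i | i. i < m \<and> w i \<noteq> 0 \<and> 0 < x i}"

lemma finite_nodes: "finite nodes"
  unfolding nodes_def by simp

lemma card_nodes_le_degree:
  assumes "R \<noteq> 0" "\<And>i. i < m \<Longrightarrow> w i \<noteq> 0 \<Longrightarrow> 0 < x i \<Longrightarrow> poly R (x i) = 0"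
  shows "card nodes \<le> degree R"
proof -
  have "card nodes \<le> card {t. poly R t = 0}"
    using assms by (intro card_mono poly_roots_finite) (auto simp: nodes_def)
  also have "\<dots> \<le> degree R" using assms(1) by (rule card_poly_roots_bound)
  finally show ?thesis .
qed

lemma card_nodes_le_alpha_breakdown:
  assumes "unbroken k" "alpha (Suc k) = 0"
  shows "card nodes \<le> k"
proof -
  have "vform (W k) (W k) = 0" using assms(2) by (simp add: alpha_Suc vform_nonneg)
  then have "card nodes \<le> degree (W k)"
    using degree_W[OF assms(1)] by (intro card_nodes_le_degree) (auto simp: vform_eq_0_iff)
  then show ?thesis using degree_W[OF assms(1)] by simp
qed

text \<open>\<open>Z k\<close> has degree \<open>k + 1\<close>, one more than \<open>W k\<close> in
  the \<alpha> case. The weaker bound suffices, because \<open>beta (Suc k)\<close> enters the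
  stopping test at index \<open>Suc k\<close>.\<close>

lemma card_nodes_le_beta_breakdown:
  assumes "unbroken k" "alpha (Suc k) \<noteq> 0" "beta (Suc k) = 0"
  shows "card nodes \<le> Suc k"
proof -
  have "uform (Z k) (Z k) = 0" using assms(3) by (simp add: beta_Suc uform_nonneg)
  moreover have dZ: "degree (Z k) = Suc k" using degree_Z[OF assms(1,2)] .
  ultimately have "card nodes \<le> degree (Z k)"
    by (intro card_nodes_le_degree) (auto simp: uform_eq_0_iff)
  then show ?thesis using dZ by simp
qed

text \<open>Otherwise the last \<open>Q\<close> has degree exactly \<open>card nodes\<close>.
  Subtracting a multiple of the node polynomial, which is null for \<open>vform\<close>, lowers the
  degree, so this \<open>Q\<close> would be orthogonal to itself although it is normalized.\<close>

lemma card_nodes_breakdown: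
  assumes "unbroken (card nodes)"
  shows "alpha (Suc (card nodes)) = 0"
proof (rule ccontr)
  let ?n = "card nodes" and ?Q = "Q (Suc (card nodes))"
  assume nz: "alpha (Suc ?n) \<noteq> 0"
  define V where "V = (\<Prod>t\<in>nodes. [:- t, 1:])"
  have V: "degree V = ?n" "lead_coeff V = 1"
    unfolding V_def by (subst degree_prod_eq_sum_degree; simp) (simp add: lead_coeff_prod)
  \<comment> \<open>At indices with \<open>x i = 0\<close> the polynomial \<open>V\<close> need not
    vanish, but there the factor from \<open>pCons 0\<close> does.\<close>
  have V0: "vform ?Q V = 0"
  proof -
    have "poly V (x i) = 0" if "i < m" "w i \<noteq> 0" "x i \<noteq> 0" for i
    proof -
      have "x i \<in> nodes" using that x_nonneg by (force simp: nodes_def less_le)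
      then show ?thesis using finite_nodes by (auto simp: V_def poly_prod)
    qed
    then show ?thesis unfolding poly_form_def by (intro sum.neutral) auto
  qed
  have Qn: "degree ?Q = ?n" using degree_W(2)[OF assms] nz by (simp add: Q_Suc)
  define R where "R = ?Q - smult (lead_coeff ?Q / lead_coeff V) V"
  have "degree R < ?n \<or> R = 0"
    unfolding R_def using degree_cancel_lead[of V ?Q] V Qn by force
  then have "vform ?Q R = 0" by (rule vform_Q_low_degree[OF assms nz order_refl])
  moreover have "?Q = R + smult (lead_coeff ?Q / lead_coeff V) V" by (simp add: R_def)
  ultimately have "vform ?Q ?Q = 0" using V0
    by (metis (no_types) add_0 mult_zero_right poly_form_add_left poly_form_smult_left vform_commute)
  then show False using vform_Q_self[OF nz] by simp
qed

text \<open>By the index shift of the quadruples, \<open>alpha (Suc k) * beta k\<close> is the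
  product \<alpha>_{k+1} \<beta>_{k+1} of the stopping test.\<close>

theorem Least_breakdown:
  "(\<exists>k. alpha (Suc k) * beta k = 0) \<and> (LEAST k. alpha (Suc k) * beta k = 0) = card nodes"
proof -
  have ex: "\<exists>k\<le>card nodes. alpha (Suc k) * beta k = 0"
  proof (rule ccontr)
    assume "\<not> ?thesis"
    then have *: "alpha (Suc k) \<noteq> 0 \<and> beta k \<noteq> 0" if "k \<le> card nodes" for k using that by auto
    have "unbroken (card nodes)" unfolding unbroken_def by (auto simp: * Suc_leI)
    then show False using card_nodes_breakdown * by blast
  qed
  define k where "k = (LEAST k. alpha (Suc k) * beta k = 0)"
  have k0: "alpha (Suc k) * beta k = 0" unfolding k_def using ex by (metis (mono_tags, lifting) LeastI)
  have less: "alpha (Suc j) \<noteq> 0 \<and> beta j \<noteq> 0" if "j < k" for j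
    using not_less_Least that unfolding k_def by fastforce
  have "k \<le> card nodes" unfolding k_def using ex by (metis (mono_tags, lifting) Least_le order_trans)
  moreover have "card nodes \<le> k"
  \<comment> \<open>If \<open>beta k\<close> vanishes, the run is known to be unbroken only up to
    \<open>k - 1\<close>, and the \<beta> bound applies there; otherwise it is unbroken up to
    \<open>k\<close> and \<alpha> is the factor that vanishes.\<close>
  proof (cases "beta k = 0")
    case True
    then obtain j where j: "k = Suc j" using beta_0_pos by (cases k) auto
    then have "unbroken j" "alpha (Suc j) \<noteq> 0" using less by (auto simp: unbroken_def)
    then show ?thesis using card_nodes_le_beta_breakdown[of j] True j by simp
  next
    case False
    have "unbroken k" unfolding unbroken_def
    proof (intro allI impI)
      fix i assume "i < k"
      then show "alpha (Suc i) \<noteq> 0 \<and> beta (Suc i) \<noteq> 0"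
        using less[of i] less[of "Suc i"] False by (cases "Suc i = k") auto
    qed
    then show ?thesis using card_nodes_le_alpha_breakdown[of k] k0 False by simp
  qed
  ultimately show ?thesis using ex unfolding k_def by auto
qed

end

section \<open>Pseudoinverse of a Gram matrix\<close>

text \<open>Side conditions on dimensions, rather than carriers with free sizes, let the simplifier
  reassociate long products.\<close>

lemma assoc_mult_mat_dim:
  "dim_col A = dim_row B \<Longrightarrow> dim_col B = dim_row C \<Longrightarrow> A * B * C = A * (B * C)"
  for A B C :: "'a :: semiring_0 mat"
  by (rule assoc_mult_mat[of A "dim_row A" "dim_col A" B "dim_col B" C "dim_col C"]) auto

lemma transpose_mult_dim: "dim_col A = dim_row B \<Longrightarrow> (A * B)\<^sup>T = B\<^sup>T * A\<^sup>T"
  for A B :: "'a :: comm_semiring_0 mat"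
  by (rule transpose_mult[of A "dim_row A" "dim_col A" B "dim_col B"]) auto

text \<open>Uniqueness in the Penrose conditions, required by the \<open>THE\<close> in
  \<open>pinv\<close>: symmetry forces \<open>M * N' = M * N\<close> and
  \<open>N' * M = N * M\<close>, whence \<open>N' = N' * M * N' = N * M * N = N\<close>.\<close>

lemma pinv_eqI:
  assumes M: "M \<in> carrier_mat k l" and N: "N \<in> carrier_mat l k"
    and "M * N * M = M" "N * M * N = N" "(M * N)\<^sup>T = M * N" "(N * M)\<^sup>T = N * M"
  shows "pinv M = N"
  unfolding pinv_def
proof (rule the_equality)
  show "N \<in> carrier_mat (dim_col M) (dim_row M) \<and>
     M * N * M = M \<and> N * M * N = N \<and> (M * N)\<^sup>T = M * N \<and> (N * M)\<^sup>T = N * M"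
    using assms by auto
next
  fix N'
  assume "N' \<in> carrier_mat (dim_col M) (dim_row M) \<and>
     M * N' * M = M \<and> N' * M * N' = N' \<and> (M * N')\<^sup>T = M * N' \<and> (N' * M)\<^sup>T = N' * M"
  then have N': "N' \<in> carrier_mat l k" and
    eq: "M * N' * M = M" "N' * M * N' = N'" "(M * N')\<^sup>T = M * N'" "(N' * M)\<^sup>T = N' * M"
    using M by auto
  note assoc = assoc_mult_mat[where ?'a = real]
  have MN: "M * N \<in> carrier_mat k k" "M * N' \<in> carrier_mat k k"
    and NM: "N * M \<in> carrier_mat l l" "N' * M \<in> carrier_mat l l"
    using M N N' by auto
  have "M * N' = (M * N * M) * N'" by (simp only: assms(3))
  also have "\<dots> = (M * N) * (M * N')" by (rule assoc[OF MN(1) M N'])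
  also have "\<dots> = ((M * N') * (M * N))\<^sup>T"
    by (simp only: transpose_mult[OF MN(2,1)] eq assms)
  also have "(M * N') * (M * N) = (M * N' * M) * N" by (rule assoc[OF MN(2) M N, symmetric])
  finally have left: "M * N' = M * N" by (simp only: eq assms)
  have "N' * M = N' * (M * N * M)" by (simp only: assms(3))
  also have "M * N * M = M * (N * M)" by (rule assoc[OF M N M])
  also have "N' * (M * (N * M)) = (N' * M) * (N * M)" by (rule assoc[OF N' M NM(1), symmetric])
  also have "\<dots> = ((N * M) * (N' * M))\<^sup>T"
    by (simp only: transpose_mult[OF NM] eq assms)
  also have "(N * M) * (N' * M) = N * (M * (N' * M))" by (rule assoc[OF N M NM(2)])
  also have "M * (N' * M) = M * N' * M" by (rule assoc[OF M N' M, symmetric])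
  finally have right: "N' * M = N * M" by (simp only: eq assms)
  have "N' = N' * (M * N')" using eq(2) assoc[OF N' M N'] by simp
  also have "\<dots> = N' * (M * N)" by (simp only: left)
  also have "\<dots> = N' * M * N" by (rule assoc[OF N' M N, symmetric])
  also have "\<dots> = N * M * N" by (simp only: right)
  finally show "N' = N" using assms(4) by simp
qed

lemma scalar_prod_self_eq_0_iff: "v \<bullet> v = 0 \<longleftrightarrow> v = 0\<^sub>v (dim_vec v)" for v :: "real vec"
proof
  assume "v \<bullet> v = 0"
  then have "\<forall>i\<in>{0..<dim_vec v}. v $ i * v $ i = 0"
    unfolding scalar_prod_def by (subst (asm) sum_nonneg_eq_0_iff) auto
  then show "v = 0\<^sub>v (dim_vec v)" by (intro eq_vecI) auto
qed (metis scalar_prod_left_zero carrier_vec_dim_vec)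

lemma scalar_prod_mult_mat_vec:
  fixes B :: "real mat"
  assumes "B \<in> carrier_mat k l" "v \<in> carrier_vec k" "x \<in> carrier_vec l"
  shows "v \<bullet> (B *\<^sub>v x) = (B\<^sup>T *\<^sub>v v) \<bullet> x"
  using assms by (metis transpose_vec_mult_scalar comm_scalar_prod mult_mat_vec_carrier transpose_carrier_mat)

text \<open>The right inverse makes \<open>F\<^sup>T\<close> injective, and a kernel vector
  \<open>x\<close> of \<open>F * F\<^sup>T\<close> satisfies
  \<open>F\<^sup>T *\<^sub>v x = 0\<close>, because the squared length of that vector is
  \<open>x \<bullet> (F * F\<^sup>T *\<^sub>v x)\<close>.\<close>

lemma gram_inverse:
  fixes F R :: "real mat"
  assumes F: "F \<in> carrier_mat r n" and R: "R \<in> carrier_mat n r" and FR: "F * R = 1\<^sub>m r"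
  obtains K where "K \<in> carrier_mat r r" "K * (F * F\<^sup>T) = 1\<^sub>m r" "F * F\<^sup>T * K = 1\<^sub>m r" "K\<^sup>T = K"
proof -
  let ?G = "F * F\<^sup>T"
  have G: "?G \<in> carrier_mat r r" using F by simp
  have "x = 0\<^sub>v r" if x: "x \<in> carrier_vec r" "?G *\<^sub>v x = 0\<^sub>v r" for x
  proof -
    have "(F\<^sup>T *\<^sub>v x) \<bullet> (F\<^sup>T *\<^sub>v x) = x \<bullet> (F *\<^sub>v (F\<^sup>T *\<^sub>v x))"
      using F x by (metis scalar_prod_mult_mat_vec mult_mat_vec_carrier transpose_carrier_mat)
    also have "\<dots> = 0" using F x by (metis assoc_mult_mat_vec scalar_prod_right_zero transpose_carrier_mat)
    finally have "F\<^sup>T *\<^sub>v x = 0\<^sub>v n" using F by (simp add: scalar_prod_self_eq_0_iff)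
    moreover have "R\<^sup>T * F\<^sup>T = 1\<^sub>m r"
      using transpose_mult[OF F R] FR by simp
    ultimately have "x = R\<^sup>T *\<^sub>v 0\<^sub>v n"
      using F R x by (metis assoc_mult_mat_vec one_mult_mat_vec transpose_carrier_mat)
    then show ?thesis using R by (auto simp: scalar_prod_def)
  qed
  then have "det ?G \<noteq> 0" using det_0_iff_vec_prod_zero_field[OF G] by blast
  from det_non_zero_imp_unit[OF G this, of undefined]
  obtain K where K: "K \<in> carrier_mat r r" "K * ?G = 1\<^sub>m r" "?G * K = 1\<^sub>m r"
    unfolding Units_def by (auto simp: ring_mat_simps)
  have "?G\<^sup>T = ?G" using F by (simp add: transpose_mult_dim)
  then have "?G * K\<^sup>T = 1\<^sub>m r" using transpose_mult[OF K(1) G] K(2) by simp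
  moreover have "K * ?G * K\<^sup>T = K * (?G * K\<^sup>T)" using K(1) by (intro assoc_mult_mat[OF _ G]) auto
  ultimately have "K\<^sup>T = K" using K by simp
  then show ?thesis using that K by blast
qed

text \<open>With \<open>K\<close> the inverse of \<open>F * F\<^sup>T\<close>, the pseudoinverse is
  \<open>F\<^sup>T * K * K * F\<close>. The second conclusion says that
  \<open>pinv M * F\<^sup>T\<close> is a right inverse of \<open>F\<close>, where
  \<open>M = F\<^sup>T * F\<close>; its columns are therefore orthonormal for
  \<open>M\<close>.\<close>

lemma pinv_gram:
  fixes F R :: "real mat"
  assumes F: "F \<in> carrier_mat r n" and R: "R \<in> carrier_mat n r" and FR: "F * R = 1\<^sub>m r"
  shows "pinv (F\<^sup>T * F) \<in> carrier_mat n n" "F * pinv (F\<^sup>T * F) * F\<^sup>T = 1\<^sub>m r"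
proof -
  obtain K where K: "K \<in> carrier_mat r r" "K * (F * F\<^sup>T) = 1\<^sub>m r" "F * F\<^sup>T * K = 1\<^sub>m r" "K\<^sup>T = K"
    using gram_inverse[OF assms] .
  define N where "N = F\<^sup>T * (K * (K * F))"
  have N: "N \<in> carrier_mat n n" using F K by (simp add: N_def)
  have KG: "K * (F * (F\<^sup>T * Z)) = Z" "F * (F\<^sup>T * (K * Z)) = Z" if "dim_row Z = r" for Z
  proof -
    have "K * (F * (F\<^sup>T * Z)) = K * (F * F\<^sup>T) * Z" "F * (F\<^sup>T * (K * Z)) = F * F\<^sup>T * K * Z"
      using F K(1) that by (simp_all add: assoc_mult_mat_dim)
    then show "K * (F * (F\<^sup>T * Z)) = Z" "F * (F\<^sup>T * (K * Z)) = Z"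
      using K(2,3) left_mult_one_mat'[OF that] by simp_all
  qed
  note dims = carrier_matD[OF F] carrier_matD[OF K(1)]
  have MN: "(F\<^sup>T * F) * N = F\<^sup>T * (K * F)" and NM: "N * (F\<^sup>T * F) = F\<^sup>T * (K * F)"
    by (simp_all add: N_def assoc_mult_mat_dim KG dims)
  have sym: "(F\<^sup>T * (K * F))\<^sup>T = F\<^sup>T * (K * F)"
    by (simp add: transpose_mult_dim K(4) dims assoc_mult_mat_dim)
  have "pinv (F\<^sup>T * F) = N"
  proof (rule pinv_eqI[of _ n n])
    show "F\<^sup>T * F * N * (F\<^sup>T * F) = F\<^sup>T * F" "N * (F\<^sup>T * F) * N = N"
      unfolding MN NM by (simp_all add: N_def assoc_mult_mat_dim KG dims)
  qed (use F N MN NM sym in auto)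
  moreover have "F * N * F\<^sup>T = 1\<^sub>m r"
    using K(2) by (simp add: N_def assoc_mult_mat_dim KG dims)
  ultimately show "pinv (F\<^sup>T * F) \<in> carrier_mat n n" "F * pinv (F\<^sup>T * F) * F\<^sup>T = 1\<^sub>m r"
    using N by auto
qed

section \<open>Reduction of the GSVD to a rank factorization of \<open>M\<close>\<close>

lemma dim_Sigma_A:
  "q1 + q2 \<le> m \<Longrightarrow> Sigma_A m q1 q2 q3 c \<in> carrier_mat m (q1 + q2 + q3)"
  unfolding Sigma_A_def by (intro carrier_matI) (auto simp: dim_diag_block_mat mat_diag_def)

lemma dim_Sigma_L:
  "q2 + q3 \<le> p \<Longrightarrow> Sigma_L p q1 q2 q3 s \<in> carrier_mat p (q1 + q2 + q3)"
  unfolding Sigma_L_def by (intro carrier_matI) (auto simp: dim_diag_block_mat mat_diag_def)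

text \<open>The two leading blocks are square, so their diagonals lie on the main diagonal; the
  last, possibly rectangular block is zero.\<close>

lemma index_Sigma_A:
  assumes "q1 + q2 \<le> m" "\<And>i. i < q1 \<Longrightarrow> c i = 1" "i < m" "j < q1 + q2 + q3"
  shows "Sigma_A m q1 q2 q3 c $$ (i, j) = (if i = j \<and> i < q1 + q2 then c i else 0)"
  using assms unfolding Sigma_A_def by (auto simp: Let_def mat_diag_def)

lemma append_zero_cols_mult:
  assumes S: "S \<in> carrier_mat k r" and Y: "Y \<in> carrier_mat n n" and "r \<le> n"
  shows "append_zero_cols S (n - r) * Y = S * mat r n (\<lambda>(i, j). Y $$ (i, j))"
proof (rule eq_matI)
  fix i j assume "i < dim_row (S * mat r n (\<lambda>(i, j). Y $$ (i, j)))"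
    "j < dim_col (S * mat r n (\<lambda>(i, j). Y $$ (i, j)))"
  then have ij: "i < k" "j < n" using S by auto
  have "(append_zero_cols S (n - r) * Y) $$ (i, j) =
      (\<Sum>t = 0..<n. (if t < r then S $$ (i, t) else 0) * Y $$ (t, j))"
    using S Y ij \<open>r \<le> n\<close> by (auto simp: append_zero_cols_def scalar_prod_def intro!: sum.cong)
  also have "\<dots> = (\<Sum>t = 0..<r. S $$ (i, t) * Y $$ (t, j))"
    using \<open>r \<le> n\<close> by (intro sum.mono_neutral_cong_right) auto
  also have "\<dots> = (S * mat r n (\<lambda>(i, j). Y $$ (i, j))) $$ (i, j)"
    using S ij by (auto simp: scalar_prod_def intro!: sum.cong)
  finally show "(append_zero_cols S (n - r) * Y) $$ (i, j) = (S * mat r n (\<lambda>(i, j). Y $$ (i, j))) $$ (i, j)" .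
qed (use S Y in \<open>auto simp: append_zero_cols_def\<close>)

text \<open>\<open>F\<close> consists of the first \<open>r\<close> rows of the inverse of
  \<open>X\<close>, and \<open>R\<close> of the first \<open>r\<close> columns of \<open>X\<close>.
  The orthogonal factors cancel in the Gram matrices, and the two diagonal parts add up to the
  identity.\<close>

lemma gsvd_gram:
  assumes M: "M = A\<^sup>T * A + L\<^sup>T * L" and gsvd: "is_gsvd m p n r q1 q2 q3 c s PA PL X A L"
  obtains F R where "F \<in> carrier_mat r n" "R \<in> carrier_mat n r" "F * R = 1\<^sub>m r"
    "A = PA * Sigma_A m q1 q2 q3 c * F" "M = F\<^sup>T * F"
proof -
  obtain Y where Y: "Y \<in> carrier_mat n n" "inverts_mat Y X"
      "A = PA * append_zero_cols (Sigma_A m q1 q2 q3 c) (n - r) * Y"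
      "L = PL * append_zero_cols (Sigma_L p q1 q2 q3 s) (n - r) * Y"
    using gsvd unfolding is_gsvd_def by blast
  note g = gsvd[unfolded is_gsvd_def]
  define F where "F = mat r n (\<lambda>(i, j). Y $$ (i, j))"
  define R where "R = mat n r (\<lambda>(i, j). X $$ (i, j))"
  define SA where "SA = Sigma_A m q1 q2 q3 c"
  define SL where "SL = Sigma_L p q1 q2 q3 s"
  have F: "F \<in> carrier_mat r n" and R: "R \<in> carrier_mat n r" by (auto simp: F_def R_def)
  have PA: "PA \<in> carrier_mat m m" "PA\<^sup>T * PA = 1\<^sub>m m"
    and PL: "PL \<in> carrier_mat p p" "PL\<^sup>T * PL = 1\<^sub>m p"
    and X: "X \<in> carrier_mat n n" and rn: "r \<le> n" using g by auto
  have SA: "SA \<in> carrier_mat m r" and SL: "SL \<in> carrier_mat p r"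
    unfolding SA_def SL_def using dim_Sigma_A dim_Sigma_L g by auto
  have S1: "SA\<^sup>T * SA + SL\<^sup>T * SL = 1\<^sub>m r" using g by (simp add: SA_def SL_def)
  have FR: "F * R = 1\<^sub>m r"
  proof (rule eq_matI)
    fix i j assume ij: "i < dim_row (1\<^sub>m r :: real mat)" "j < dim_col (1\<^sub>m r :: real mat)"
    then have "(F * R) $$ (i, j) = (Y * X) $$ (i, j)"
      using Y X rn by (auto simp: F_def R_def scalar_prod_def intro!: sum.cong)
    then show "(F * R) $$ (i, j) = 1\<^sub>m r $$ (i, j)"
      using Y ij rn by (simp add: inverts_mat_def)
  qed (auto simp: F_def R_def)
  have gram: "B\<^sup>T * B = F\<^sup>T * (S\<^sup>T * S) * F"
    if "P \<in> carrier_mat k k" "P\<^sup>T * P = 1\<^sub>m k" "S \<in> carrier_mat k r" "B = P * append_zero_cols S (n - r) * Y"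
    for P S B k
  proof -
    have az: "append_zero_cols S (n - r) \<in> carrier_mat k n"
      using that(3) rn by (auto simp: append_zero_cols_def)
    have "B = P * (S * F)"
      unfolding that(4) using append_zero_cols_mult[OF that(3) Y(1) rn] assoc_mult_mat[OF that(1) az Y(1)]
      by (simp add: F_def)
    moreover have "P\<^sup>T * (P * Z) = Z" if "Z \<in> carrier_mat k n" for Z
    proof -
      have "P\<^sup>T * (P * Z) = P\<^sup>T * P * Z"
        using that \<open>P \<in> carrier_mat k k\<close> by (simp add: assoc_mult_mat_dim)
      then show ?thesis using that \<open>P\<^sup>T * P = 1\<^sub>m k\<close> by simp
    qed
    ultimately show ?thesis
      using that(1,3) F by (simp add: transpose_mult_dim assoc_mult_mat_dim)
  qed
  have "M = F\<^sup>T * (SA\<^sup>T * SA) * F + F\<^sup>T * (SL\<^sup>T * SL) * F"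
    using gram[OF PA SA] gram[OF PL SL] Y(3,4) by (simp add: M SA_def SL_def)
  also have "\<dots> = (F\<^sup>T * (SA\<^sup>T * SA) + F\<^sup>T * (SL\<^sup>T * SL)) * F"
    using F SA SL by (intro add_mult_distrib_mat[symmetric]) auto
  also have "F\<^sup>T * (SA\<^sup>T * SA) + F\<^sup>T * (SL\<^sup>T * SL) = F\<^sup>T * (SA\<^sup>T * SA + SL\<^sup>T * SL)"
    using F SA SL by (intro mult_add_distrib_mat[symmetric]) auto
  finally have "M = F\<^sup>T * F" using F S1 by simp
  moreover have "A = PA * SA * F"
  proof -
    have "append_zero_cols SA (n - r) \<in> carrier_mat m n"
      using SA rn by (auto simp: append_zero_cols_def)
    then have "A = PA * (SA * F)"
      using Y(3) append_zero_cols_mult[OF SA Y(1) rn] assoc_mult_mat[OF PA(1) _ Y(1)]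
      by (simp add: F_def SA_def)
    then show ?thesis using assoc_mult_mat[OF PA(1) SA F] by simp
  qed
  ultimately show ?thesis using that F R FR by (simp add: SA_def)
qed

section \<open>The gGKB process in diagonalizing coordinates\<close>

text \<open>
  \<open>U g\<close> and \<open>V f\<close> are the vectors with coordinates \<open>g\<close> and \<open>f\<close> in bases in which the operator and
  its adjoint are diagonal; the coordinates at indices \<open>\<ge> k\<close> are in the kernels.
\<close>

locale diagonalized_gkb =
  fixes A M :: "real mat" and b :: "real vec" and U V :: "(nat \<Rightarrow> real) \<Rightarrow> real vec"
    and m k r :: nat and \<sigma> y :: "nat \<Rightarrow> real"
  assumes km: "k \<le> m" and kr: "k \<le> r" and \<sigma>_0: "\<And>i. k \<le> i \<Longrightarrow> \<sigma> i = 0"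
    and norm2_U: "\<And>g. norm2 (U g) = sqrt (\<Sum>i<m. (g i)\<^sup>2)"
    and mnorm_V: "\<And>f. mnorm M (V f) = sqrt (\<Sum>i<r. (f i)\<^sup>2)"
    and lin_U: "\<And>g h t. U g - t \<cdot>\<^sub>v U h = U (\<lambda>i. g i - t * h i)" "\<And>g t. t \<cdot>\<^sub>v U g = U (\<lambda>i. t * g i)"
    and lin_V: "\<And>f h t. V f - t \<cdot>\<^sub>v V h = V (\<lambda>i. f i - t * h i)" "\<And>f t. t \<cdot>\<^sub>v V f = V (\<lambda>i. t * f i)"
    and A_V: "\<And>f. A *\<^sub>v V f = U (\<lambda>i. \<sigma> i * f i)"
    and adj_U: "\<And>g. (pinv M * A\<^sup>T) *\<^sub>v U g = V (\<lambda>i. \<sigma> i * g i)"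
    and V_0: "V (\<lambda>_. 0) = 0\<^sub>v (dim_col A)"
    and b: "b = U y"
begin

abbreviation "w i \<equiv> (y i)\<^sup>2"
abbreviation "x i \<equiv> (\<sigma> i)\<^sup>2"

lemma norm2_U_poly: "norm2 (U (\<lambda>i. poly P (x i) * y i)) = sqrt (poly_form m w x P P)"
  by (simp add: norm2_U poly_form_def power2_eq_square mult_ac)

text \<open>The norm runs over \<open>r\<close> coordinates and the form over \<open>m\<close>; both
  sums reduce to the first \<open>k\<close> indices, beyond which \<sigma> vanishes.\<close>

lemma mnorm_V_poly:
  "mnorm M (V (\<lambda>i. \<sigma> i * poly P (x i) * y i)) = sqrt (poly_form m w x P (pCons 0 P))"
proof -
  have restrict: "(\<Sum>i<N. (\<sigma> i * poly P (x i) * y i)\<^sup>2) = (\<Sum>i<k. (\<sigma> i * poly P (x i) * y i)\<^sup>2)"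
    if "k \<le> N" for N
    using that by (intro sum.mono_neutral_right) (auto simp: \<sigma>_0)
  have "poly_form m w x P (pCons 0 P) = (\<Sum>i<m. (\<sigma> i * poly P (x i) * y i)\<^sup>2)"
    by (simp add: poly_form_def power2_eq_square mult_ac)
  then show ?thesis using restrict[OF km] restrict[OF kr] by (simp add: mnorm_V)
qed

text \<open>The equality holds for every \<open>i\<close>, also after a breakdown, since both
  recursions divide by zero in the same way.\<close>

lemma ggkb_eq_gk_poly:
  "ggkb A M b i = (case gk_poly m w x i of (\<alpha>, Q, \<beta>, P) \<Rightarrow>
     (\<alpha>, V (\<lambda>i. \<sigma> i * poly Q (x i) * y i), \<beta>, U (\<lambda>i. poly P (x i) * y i)))"
proof (induction i)
  case 0
  have "norm2 b = sqrt (poly_form m w x 1 1)" using norm2_U_poly[of 1] by (simp add: b)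
  then show ?case by (simp add: V_0 b lin_U Let_def)
next
  case (Suc i)
  obtain \<alpha> Q \<beta> P where eq: "gk_poly m w x i = (\<alpha>, Q, \<beta>, P)" by (cases "gk_poly m w x i") auto
  define W where "W = P - smult \<beta> Q"
  define \<alpha>' where "\<alpha>' = sqrt (poly_form m w x W (pCons 0 W))"
  define Q' where "Q' = smult (1 / \<alpha>') W"
  define Z where "Z = pCons 0 Q' - smult \<alpha>' P"
  let ?v = "\<lambda>Q. V (\<lambda>i. \<sigma> i * poly Q (x i) * y i)" and ?u = "\<lambda>P. U (\<lambda>i. poly P (x i) * y i)"
  have W: "(pinv M * A\<^sup>T) *\<^sub>v ?u P - \<beta> \<cdot>\<^sub>v ?v Q = ?v W"
    unfolding adj_U lin_V(1) by (simp add: W_def algebra_simps)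
  have Q': "(1 / \<alpha>') \<cdot>\<^sub>v ?v W = ?v Q'"
    by (simp add: lin_V Q'_def algebra_simps)
  \<comment> \<open>One factor \<sigma> comes from \<open>A\<close> and one from the coordinates of
    \<open>?v Q'\<close>; together they are the node \<open>x i\<close>, that is, multiplication by
    the variable.\<close>
  have Z: "A *\<^sub>v ?v Q' - \<alpha>' \<cdot>\<^sub>v ?u P = ?u Z"
    unfolding A_V lin_U(1) by (simp add: Z_def algebra_simps power2_eq_square)
  have P': "t \<cdot>\<^sub>v ?u Z = ?u (smult t Z)" for t
    by (simp add: lin_U algebra_simps)
  have lhs: "ggkb A M b (Suc i) =
      (\<alpha>', ?v Q', norm2 (?u Z), ?u (smult (1 / norm2 (?u Z)) Z))"
    using Suc by (simp add: eq W Let_def mnorm_V_poly \<alpha>'_def[symmetric] Q' Z P' del: times_divide_eq_left)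
  have rhs: "gk_poly m w x (Suc i) =
      (\<alpha>', Q', norm2 (?u Z), smult (1 / norm2 (?u Z)) Z)"
    by (simp add: eq Let_def W_def[symmetric] \<alpha>'_def[symmetric] Q'_def[symmetric] Z_def[symmetric] norm2_U_poly)
  show ?case unfolding lhs rhs by simp
qed

lemma Least_ggkb_breakdown:
  assumes "y i \<noteq> 0" "i < m"
  shows "(\<exists>j. ggkb_alpha A M b (j + 1) * ggkb_beta A M b (j + 1) = 0) \<and>
    (LEAST j. ggkb_alpha A M b (j + 1) * ggkb_beta A M b (j + 1) = 0)
      = card {(\<sigma> i)\<^sup>2 | i. i < k \<and> \<sigma> i \<noteq> 0 \<and> y i \<noteq> 0}"
proof -
  interpret gk: gk_polynomials m w x by standard (use assms in auto)
  have "gk.nodes = {(\<sigma> i)\<^sup>2 | i. i < k \<and> \<sigma> i \<noteq> 0 \<and> y i \<noteq> 0}"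
  proof -
    have "i < m \<and> w i \<noteq> 0 \<and> 0 < x i \<longleftrightarrow> i < k \<and> \<sigma> i \<noteq> 0 \<and> y i \<noteq> 0" for i
      using km \<sigma>_0[of i] by (cases "i < k") auto
    then show ?thesis unfolding gk.nodes_def by simp
  qed
  \<comment> \<open>\<open>ggkb_beta\<close> at \<open>j + 1\<close> reads the quadruple with index
    \<open>j\<close>, which matches the shift in \<open>gk.Least_breakdown\<close>.\<close>
  moreover have "ggkb_alpha A M b (j + 1) = fst (gk_poly m w x (Suc j))"
      "ggkb_beta A M b (j + 1) = fst (snd (snd (gk_poly m w x j)))" for j
    unfolding ggkb_alpha_def ggkb_beta_def by (simp_all only: ggkb_eq_gk_poly case_prod_unfold) simp_all
  ultimately show ?thesis using gk.Least_breakdown by simp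
qed

end

section \<open>Spans of columns and orthogonal projections onto them\<close>

text \<open>The vectors orthogonal to \<open>x\<close> form a submodule that contains
  \<open>S\<close>, hence also its span.\<close>

lemma vspan_orthogonal:
  assumes S: "S \<subseteq> carrier_vec m" and x: "x \<in> carrier_vec m"
    and orth: "\<And>v. v \<in> S \<Longrightarrow> x \<bullet> v = 0" and g: "g \<in> vspan m S"
  shows "x \<bullet> g = 0"
proof -
  interpret vec_space "TYPE(real)" m .
  let ?H = "{v \<in> carrier_vec m. x \<bullet> v = 0}"
  have "LinearCombinations.submodule class_ring ?H V"
    by (rule LinearCombinations.submodule.intro)
      (use x in \<open>auto simp: module_vec_simps class_ring_simps scalar_prod_add_distrib[of _ m] vec_module\<close>)
  moreover have "S \<subseteq> ?H" using S orth by auto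
  ultimately have "span S \<subseteq> ?H" by (intro span_is_subset) auto
  then show ?thesis using g by (auto simp: vspan_def)
qed

lemma vspan_carrier: "S \<subseteq> carrier_vec m \<Longrightarrow> vspan m S \<subseteq> carrier_vec m"
proof -
  interpret vec_space "TYPE(real)" m .
  assume "S \<subseteq> carrier_vec m"
  then show ?thesis unfolding vspan_def using span_is_subset2 by simp
qed

text \<open>Settles the \<open>THE\<close> in \<open>orth_proj\<close>: the difference of two
  candidates lies orthogonal to itself.\<close>

lemma orth_proj_eqI:
  assumes G: "G \<subseteq> carrier_vec m" and x: "x \<in> carrier_vec m" and w: "w \<in> G"
    and orth: "\<And>g. g \<in> G \<Longrightarrow> (x - w) \<bullet> g = 0"
  shows "orth_proj m G x = w"
  unfolding orth_proj_def
proof (rule the_equality)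
  show "w \<in> G \<and> w \<in> carrier_vec m \<and> (\<forall>g\<in>G. (x - w) \<bullet> g = 0)" using assms by auto
next
  fix w' assume w': "w' \<in> G \<and> w' \<in> carrier_vec m \<and> (\<forall>g\<in>G. (x - w') \<bullet> g = 0)"
  have car: "w \<in> carrier_vec m" "w' \<in> carrier_vec m" using w w' G by auto
  have "x \<bullet> w = w \<bullet> w" "x \<bullet> w' = w \<bullet> w'" "x \<bullet> w = w' \<bullet> w" "x \<bullet> w' = w' \<bullet> w'"
    using orth[OF w] orth[of w'] w w' car x by (auto simp: minus_scalar_prod_distrib[of _ m])
  then have "(w' - w) \<bullet> (w' - w) = 0"
    using car by (simp add: minus_scalar_prod_distrib[of _ m] scalar_prod_minus_distrib[of _ m])
  then have "w' - w = 0\<^sub>v m" using car scalar_prod_self_eq_0_iff[of "w' - w"] by simp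
  then show "w' = w"
  proof (intro eq_vecI)
    fix i assume "i < dim_vec w"
    then have "(w' - w) $ i = 0" using \<open>w' - w = 0\<^sub>v m\<close> car by simp
    then show "w' $ i = w $ i" using \<open>i < dim_vec w\<close> car by simp
  qed (use car in simp)
qed

text \<open>Adding one index at a time avoids a linear combination over the set of columns, in which
  equal columns of \<open>P\<close> would merge.\<close>

lemma mult_mat_vec_in_vspan:
  assumes P: "P \<in> carrier_mat m m" and I: "I \<subseteq> {..<m}"
  shows "P *\<^sub>v vec m (\<lambda>i. if i \<in> I then z i else 0) \<in> vspan m (col P ` I)"
proof -
  interpret vec_space "TYPE(real)" m .
  have fin: "finite I" using I finite_subset by blast
  then show ?thesis using I
  proof (induction I)
    case empty
    have "P *\<^sub>v 0\<^sub>v m = 0\<^sub>v m" using P by (intro eq_vecI) auto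
    moreover have "vec m (\<lambda>i. if i \<in> {} then z i else 0) = 0\<^sub>v m" by auto
    ultimately show ?case using LinearCombinations.submodule.zero_closed[OF span_is_submodule[of "{}"]]
      by (simp add: vspan_def)
  next
    case (insert j I)
    let ?e = "\<lambda>I. vec m (\<lambda>i. if i \<in> I then z i else 0)"
    have sub: "col P ` insert j I \<subseteq> carrier_vec m" using P by (auto simp: col_def)
    have "P *\<^sub>v ?e I \<in> span (col P ` insert j I)"
      using insert span_is_monotone[of "col P ` I" "col P ` insert j I"] by (auto simp: vspan_def)
    moreover have "z j \<cdot>\<^sub>v col P j \<in> span (col P ` insert j I)"
      using in_own_span[OF sub] by (intro smult_in_span[OF sub]) auto
    moreover have "P *\<^sub>v ?e (insert j I) = P *\<^sub>v ?e I + z j \<cdot>\<^sub>v col P j"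
    proof (rule eq_vecI)
      fix i assume "i < dim_vec (P *\<^sub>v ?e I + z j \<cdot>\<^sub>v col P j)"
      then have i: "i < m" using P by simp
      have j: "j < m" using insert by simp
      have "(P *\<^sub>v ?e (insert j I)) $ i = (\<Sum>t=0..<m. P $$ (i,t) * (if t \<in> insert j I then z t else 0))"
        using P i by (auto simp: scalar_prod_def)
      also have "\<dots> = (\<Sum>t=0..<m. P $$ (i,t) * (if t \<in> I then z t else 0) + (if t = j then P $$ (i,j) * z j else 0))"
        using insert by (intro sum.cong) auto
      also have "\<dots> = (\<Sum>t=0..<m. P $$ (i,t) * (if t \<in> I then z t else 0)) + P $$ (i,j) * z j"
        using j by (simp add: sum.distrib)
      also have "\<dots> = (P *\<^sub>v ?e I + z j \<cdot>\<^sub>v col P j) $ i"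
        using P i j by (auto simp: scalar_prod_def)
      finally show "(P *\<^sub>v ?e (insert j I)) $ i = (P *\<^sub>v ?e I + z j \<cdot>\<^sub>v col P j) $ i" .
    qed (use P in auto)
    ultimately show ?case using span_add1[OF sub] by (simp add: vspan_def)
  qed
qed

text \<open>In the orthonormal basis of the columns of \<open>P\<close>, projecting means keeping
  the coordinates of \<open>b\<close> with index in \<open>I\<close>; this gives the witness
  \<open>P *\<^sub>v z\<close>.\<close>

lemma orth_proj_cols_eq_0_iff:
  assumes P: "P \<in> carrier_mat m m" "P\<^sup>T * P = 1\<^sub>m m" and I: "I \<subseteq> {..<m}" and b: "b \<in> carrier_vec m"
  shows "orth_proj m (vspan m (col P ` I)) b = 0\<^sub>v m \<longleftrightarrow> (\<forall>i\<in>I. (P\<^sup>T *\<^sub>v b) $ i = 0)"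
proof -
  define y where "y = P\<^sup>T *\<^sub>v b"
  define z where "z = vec m (\<lambda>i. if i \<in> I then y $ i else 0)"
  have S: "col P ` I \<subseteq> carrier_vec m" using P by (auto simp: col_def)
  have z: "z \<in> carrier_vec m" by (simp add: z_def)
  have w: "P *\<^sub>v z \<in> vspan m (col P ` I)" unfolding z_def by (rule mult_mat_vec_in_vspan[OF P(1) I])
  have Pz: "P\<^sup>T *\<^sub>v (P *\<^sub>v z) = z"
    using P z by (metis assoc_mult_mat_vec one_mult_mat_vec transpose_carrier_mat)
  have coeff: "v \<bullet> col P i = (P\<^sup>T *\<^sub>v v) $ i" if "i < m" "v \<in> carrier_vec m" for v i
    using that P by (simp add: comm_scalar_prod[of v m])
  have "(b - P *\<^sub>v z) \<bullet> v = 0" if v: "v \<in> col P ` I" for v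
  proof -
    obtain i where i: "v = col P i" "i \<in> I" "i < m" using v I by auto
    have "b \<bullet> v - (P *\<^sub>v z) \<bullet> v = y $ i - z $ i"
      using i P z b by (simp add: coeff Pz y_def)
    then show ?thesis using i P z b S by (simp add: minus_scalar_prod_distrib[of _ m] z_def)
  qed
  then have "(b - P *\<^sub>v z) \<bullet> v = 0" if "v \<in> vspan m (col P ` I)" for v
    using vspan_orthogonal[OF S _ _ that] P z b by simp
  then have "orth_proj m (vspan m (col P ` I)) b = P *\<^sub>v z"
    by (rule orth_proj_eqI[OF vspan_carrier[OF S] b w])
  moreover have "P *\<^sub>v z = 0\<^sub>v m \<longleftrightarrow> z = 0\<^sub>v m"
  proof
    assume "P *\<^sub>v z = 0\<^sub>v m"
    then have "z = P\<^sup>T *\<^sub>v 0\<^sub>v m" using Pz by simp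
    then show "z = 0\<^sub>v m" using P by auto
  qed (use P in auto)
  moreover have "z = 0\<^sub>v m \<longleftrightarrow> (\<forall>i\<in>I. y $ i = 0)"
    using I by (force simp: z_def vec_eq_iff)
  ultimately show ?thesis by (simp add: y_def)
qed

section \<open>Diagonalizing bases from the GSVD and the final count\<close>

lemma minus_smult_mult_mat_vec:
  fixes B :: "real mat"
  assumes "B \<in> carrier_mat k l"
  shows "B *\<^sub>v vec l g - t \<cdot>\<^sub>v (B *\<^sub>v vec l h) = B *\<^sub>v vec l (\<lambda>i. g i - t * h i)"
    and "t \<cdot>\<^sub>v (B *\<^sub>v vec l g) = B *\<^sub>v vec l (\<lambda>i. t * g i)"
proof -
  show "B *\<^sub>v vec l g - t \<cdot>\<^sub>v (B *\<^sub>v vec l h) = B *\<^sub>v vec l (\<lambda>i. g i - t * h i)"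
  proof (rule eq_vecI)
    fix i assume "i < dim_vec (B *\<^sub>v vec l (\<lambda>i. g i - t * h i))"
    then show "(B *\<^sub>v vec l g - t \<cdot>\<^sub>v (B *\<^sub>v vec l h)) $ i = (B *\<^sub>v vec l (\<lambda>i. g i - t * h i)) $ i"
      using assms by (simp add: scalar_prod_def sum_distrib_left sum_subtractf right_diff_distrib mult.left_commute)
  qed (use assms in simp)
  show "t \<cdot>\<^sub>v (B *\<^sub>v vec l g) = B *\<^sub>v vec l (\<lambda>i. t * g i)"
  proof (rule eq_vecI)
    fix i assume "i < dim_vec (B *\<^sub>v vec l (\<lambda>i. t * g i))"
    then show "(t \<cdot>\<^sub>v (B *\<^sub>v vec l g)) $ i = (B *\<^sub>v vec l (\<lambda>i. t * g i)) $ i"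
      using assms by (simp add: scalar_prod_def sum_distrib_left mult.left_commute)
  qed (use assms in simp)
qed

text \<open>\<open>U\<close> uses the columns of \<open>PA\<close> as basis, \<open>V\<close> those
  of \<open>B = pinv M * F\<^sup>T\<close>. Since \<open>F * B\<close> is the identity, the latter
  are orthonormal for \<open>M\<close>, \<open>A\<close> takes \<open>V\<close> to \<open>U\<close>
  through \<open>Sigma_A\<close>, and \<open>pinv M * A\<^sup>T\<close> takes \<open>U\<close> to
  \<open>V\<close> through its transpose.\<close>

lemma diagonalized_gkb_gsvd:
  fixes A M L PA PL X :: "real mat"
  assumes M: "M = A\<^sup>T * A + L\<^sup>T * L" and gsvd: "is_gsvd m p n r q1 q2 q3 c s PA PL X A L"
    and b: "b \<in> carrier_vec m"
  shows "\<exists>U V. diagonalized_gkb A M b U V m (q1 + q2) r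
    (\<lambda>i. if i < q1 + q2 then c i else 0) (\<lambda>i. (PA\<^sup>T *\<^sub>v b) $ i)"
proof -
  obtain F R where F: "F \<in> carrier_mat r n" and R: "R \<in> carrier_mat n r" "F * R = 1\<^sub>m r"
    and A_eq: "A = PA * Sigma_A m q1 q2 q3 c * F" and M_eq: "M = F\<^sup>T * F"
    using gsvd_gram[OF M gsvd] .
  define N where "N = pinv M"
  define S where "S = Sigma_A m q1 q2 q3 c"
  \<comment> \<open>The cut-off makes \<sigma> zero at all later indices, including those from
    \<open>r\<close> on, where the GSVD leaves \<open>c\<close> unconstrained.\<close>
  define \<sigma> where "\<sigma> = (\<lambda>i. if i < q1 + q2 then c i else 0)"
  have N: "N \<in> carrier_mat n n" "F * N * F\<^sup>T = 1\<^sub>m r"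
    using pinv_gram[OF F R] by (simp_all add: N_def M_eq)
  have g: "q1 + q2 + q3 = r" "q1 + q2 \<le> m" "\<And>i. i < q1 \<Longrightarrow> c i = 1"
    and PA: "PA \<in> carrier_mat m m" "PA\<^sup>T * PA = 1\<^sub>m m"
    using gsvd by (auto simp: is_gsvd_def)
  have S: "S \<in> carrier_mat m r" unfolding S_def using dim_Sigma_A[OF g(2), of q3 c] g(1) by simp
  have S_index: "S $$ (i, j) = (if i = j then \<sigma> i else 0)" if "i < m" "j < r" for i j
    using index_Sigma_A[of q1 q2 m c, OF g(2,3)] that g(1) by (simp add: S_def \<sigma>_def)
  have S_mult: "S *\<^sub>v vec r f = vec m (\<lambda>i. \<sigma> i * f i)" for f
  proof (rule eq_vecI)
    fix i assume "i < dim_vec (vec m (\<lambda>i. \<sigma> i * f i))"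
    then have i: "i < m" by simp
    then have "(S *\<^sub>v vec r f) $ i = (\<Sum>j = 0..<r. (if i = j then \<sigma> i else 0) * f j)"
      using S by (auto simp: scalar_prod_def S_index)
    also have "\<dots> = (\<Sum>j = 0..<r. if i = j then \<sigma> i * f i else 0)" by (intro sum.cong) auto
    finally show "(S *\<^sub>v vec r f) $ i = vec m (\<lambda>i. \<sigma> i * f i) $ i"
      using i g(1) by (auto simp: \<sigma>_def)
  qed (use S in auto)
  have ST_mult: "S\<^sup>T *\<^sub>v vec m f = vec r (\<lambda>i. \<sigma> i * f i)" for f
  proof (rule eq_vecI)
    fix i assume "i < dim_vec (vec r (\<lambda>i. \<sigma> i * f i))"
    then have i: "i < r" by simp
    then have "(S\<^sup>T *\<^sub>v vec m f) $ i = (\<Sum>j = 0..<m. (if j = i then \<sigma> j else 0) * f j)"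
      using S by (auto simp: scalar_prod_def S_index)
    also have "\<dots> = (\<Sum>j = 0..<m. if i = j then \<sigma> i * f i else 0)" by (intro sum.cong) auto
    finally show "(S\<^sup>T *\<^sub>v vec m f) $ i = vec r (\<lambda>i. \<sigma> i * f i) $ i"
      using i g(2) by (auto simp: \<sigma>_def)
  qed (use S in auto)
  have sq: "vec l f \<bullet> vec l f = (\<Sum>i<l. (f i)\<^sup>2)" for l and f :: "nat \<Rightarrow> real"
    by (simp add: scalar_prod_def power2_eq_square lessThan_atLeast0)
  define U where "U = (\<lambda>f. PA *\<^sub>v vec m f)"
  define B where "B = N * F\<^sup>T"
  define V where "V = (\<lambda>f. B *\<^sub>v vec r f)"
  have B: "B \<in> carrier_mat n r" using N F by (simp add: B_def)
  have FV: "F *\<^sub>v V f = vec r f" for f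
  proof -
    have "F * B = 1\<^sub>m r" using N F by (simp add: B_def assoc_mult_mat_dim)
    then show ?thesis unfolding V_def using assoc_mult_mat_vec[OF F B, of "vec r f"] by simp
  qed
  have V: "V f \<in> carrier_vec n" for f using B by (simp add: V_def)
  have PA_U: "PA\<^sup>T *\<^sub>v U f = vec m f" for f
    unfolding U_def using PA assoc_mult_mat_vec[of "PA\<^sup>T" m m PA m "vec m f"] by simp
  have U: "U f \<in> carrier_vec m" for f using PA by (simp add: U_def)
  have "diagonalized_gkb A M b U V m (q1 + q2) r \<sigma> (\<lambda>i. (PA\<^sup>T *\<^sub>v b) $ i)"
  proof
    show "norm2 (U f) = sqrt (\<Sum>i<m. (f i)\<^sup>2)" for f
    proof -
      have "U f \<bullet> U f = (PA\<^sup>T *\<^sub>v U f) \<bullet> vec m f"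
        using scalar_prod_mult_mat_vec[OF PA(1) U] by (simp add: U_def)
      then show ?thesis by (simp add: norm2_def PA_U sq)
    qed
    show "mnorm M (V f) = sqrt (\<Sum>i<r. (f i)\<^sup>2)" for f
    proof -
      have "M *\<^sub>v V f = F\<^sup>T *\<^sub>v vec r f"
        unfolding M_eq using assoc_mult_mat_vec[of "F\<^sup>T" n r F n "V f"] F V FV by simp
      then have "V f \<bullet> (M *\<^sub>v V f) = (F *\<^sub>v V f) \<bullet> vec r f"
        using scalar_prod_mult_mat_vec[of "F\<^sup>T" n r "V f" "vec r f"] F V by simp
      then show ?thesis by (simp add: mnorm_def FV sq)
    qed
    show "A *\<^sub>v V f = U (\<lambda>i. \<sigma> i * f i)" for f
    proof -
      have "A *\<^sub>v V f = PA * S *\<^sub>v vec r f"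
        unfolding A_eq S_def[symmetric] using assoc_mult_mat_vec[of "PA * S" m r F n "V f"] PA S F V FV by simp
      then show ?thesis
        using assoc_mult_mat_vec[OF PA(1) S, of "vec r f"] by (simp add: U_def S_mult)
    qed
    show "(pinv M * A\<^sup>T) *\<^sub>v U f = V (\<lambda>i. \<sigma> i * f i)" for f
    proof -
      have "pinv M * A\<^sup>T = B * S\<^sup>T * PA\<^sup>T"
        unfolding A_eq S_def[symmetric] N_def[symmetric] B_def
        using PA S F N by (simp add: transpose_mult_dim assoc_mult_mat_dim)
      then have "(pinv M * A\<^sup>T) *\<^sub>v U f = B * S\<^sup>T *\<^sub>v vec m f"
        using assoc_mult_mat_vec[of "B * S\<^sup>T" n m "PA\<^sup>T" m "U f"] PA S B U PA_U by simp
      then show ?thesis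
        using assoc_mult_mat_vec[of B n r "S\<^sup>T" m "vec m f"] B S by (simp add: V_def ST_mult)
    qed
    show "V (\<lambda>_. 0) = 0\<^sub>v (dim_col A)"
      using B F unfolding A_eq V_def by (intro eq_vecI) (auto simp: scalar_prod_def)
    show "b = U (\<lambda>i. (PA\<^sup>T *\<^sub>v b) $ i)"
    proof -
      have "PA * PA\<^sup>T = 1\<^sub>m m" using mat_mult_left_right_inverse[of "PA\<^sup>T" m PA] PA by simp
      then have "b = PA *\<^sub>v (PA\<^sup>T *\<^sub>v b)"
        using assoc_mult_mat_vec[of PA m m "PA\<^sup>T" m b] PA b by simp
      moreover have "vec m (\<lambda>i. (PA\<^sup>T *\<^sub>v b) $ i) = PA\<^sup>T *\<^sub>v b" using PA by (intro eq_vecI) auto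
      ultimately show ?thesis by (simp add: U_def)
    qed
  qed (use g minus_smult_mult_mat_vec[OF PA(1)] minus_smult_mult_mat_vec[OF B] in
      \<open>auto simp: \<sigma>_def U_def V_def\<close>)
  then show ?thesis unfolding \<sigma>_def by blast
qed

theorem theorem4p1:
  fixes A L M PA PL X :: "real mat" and b :: "real vec"
    and c s d :: "nat \<Rightarrow> real" and G :: "nat \<Rightarrow> real vec set"
    and m n p r q1 q2 q3 l :: nat
  assumes "A \<in> carrier_mat m n" and "L \<in> carrier_mat p n"
    and "vec_space.rank (m + p) (A @\<^sub>r L) = r"
    and "M = A\<^sup>T * A + L\<^sup>T * L"
    and "is_gsvd m p n r q1 q2 q3 c s PA PL X A L"
    and "b \<in> carrier_vec m" and "b \<noteq> 0\<^sub>v m"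
    and "bij_betw d {1..l} {c i | i. i < r \<and> 0 < c i}"
    and "\<And>j. j \<in> {1..l} \<Longrightarrow> G j = vspan m {col PA i | i. i < r \<and> c i = d j}"
  shows "(\<exists>k. ggkb_alpha A M b (k + 1) * ggkb_beta A M b (k + 1) = 0) \<and>
    (LEAST k. ggkb_alpha A M b (k + 1) * ggkb_beta A M b (k + 1) = 0)
      = card {j \<in> {1..l}. orth_proj m (G j) b \<noteq> 0\<^sub>v m}"
proof -
  note g = \<open>is_gsvd m p n r q1 q2 q3 c s PA PL X A L\<close>
  have PA: "PA \<in> carrier_mat m m" "PA\<^sup>T * PA = 1\<^sub>m m" and q: "q1 + q2 \<le> m" "q1 + q2 + q3 = r"
    and "\<forall>i<q1. c i = 1" and "\<forall>i\<in>{q1..<q1 + q2}. 0 < c i" and "\<forall>i\<in>{q1 + q2..<r}. c i = 0"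
    using g unfolding is_gsvd_def by blast+
  then have c_pos: "0 < c i" if "i < q1 + q2" for i using that by (cases "i < q1") auto
  have c_0: "c i = 0" if "q1 + q2 \<le> i" "i < r" for i
    using that \<open>\<forall>i\<in>{q1 + q2..<r}. c i = 0\<close> by simp
  let ?y = "PA\<^sup>T *\<^sub>v b" and ?q = "q1 + q2"
  obtain U V where dg: "diagonalized_gkb A M b U V m ?q r (\<lambda>i. if i < ?q then c i else 0) (\<lambda>i. ?y $ i)"
    using diagonalized_gkb_gsvd[OF \<open>M = _\<close> g \<open>b \<in> carrier_vec m\<close>] by blast
  \<comment> \<open>Since \<open>PA\<^sup>T\<close> is injective, a nonzero \<open>b\<close> leaves
    some node with positive mass.\<close>
  obtain i0 where i0: "i0 < m" "?y $ i0 \<noteq> 0"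
  proof -
    have "?y \<noteq> 0\<^sub>v m"
    proof
      assume "?y = 0\<^sub>v m"
      moreover have "PA * PA\<^sup>T = 1\<^sub>m m" using mat_mult_left_right_inverse[of "PA\<^sup>T" m PA] PA by simp
      ultimately have "b = PA *\<^sub>v 0\<^sub>v m"
        using assoc_mult_mat_vec[of PA m m "PA\<^sup>T" m b] PA \<open>b \<in> carrier_vec m\<close> by simp
      then show False using \<open>b \<noteq> 0\<^sub>v m\<close> PA by auto
    qed
    then show ?thesis using that PA by (auto simp: vec_eq_iff)
  qed
  define J where "J = {j \<in> {1..l}. orth_proj m (G j) b \<noteq> 0\<^sub>v m}"
  have pos_iff: "i < r \<and> 0 < c i \<longleftrightarrow> i < ?q" for i
    using c_pos c_0 q by (cases "i < ?q") auto
  then have d: "inj_on d {1..l}" "d ` {1..l} = {c i | i. i < ?q}"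
    using \<open>bij_betw d {1..l} _\<close> unfolding bij_betw_def by auto
  have d_pos: "0 < d j" if "j \<in> {1..l}" for j
  proof -
    have "d j \<in> {c i | i. i < ?q}" using d(2) that by blast
    then show ?thesis using c_pos by auto
  qed
  have J: "J = {j \<in> {1..l}. \<exists>i<?q. c i = d j \<and> ?y $ i \<noteq> 0}"
  proof -
    have "orth_proj m (G j) b = 0\<^sub>v m \<longleftrightarrow> (\<forall>i<?q. c i = d j \<longrightarrow> ?y $ i = 0)" if "j \<in> {1..l}" for j
    proof -
      let ?I = "{i. i < ?q \<and> c i = d j}"
      \<comment> \<open>As \<open>d j\<close> is positive, indices with \<open>c i = 0\<close> drop
        out of the spanning set, and with them the range beyond \<open>q1 + q2\<close>.\<close>
      have "i < r \<and> c i = d j \<longleftrightarrow> i < ?q \<and> c i = d j" for i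
        using d_pos[OF that] pos_iff[of i] by auto
      then have "G j = vspan m (col PA ` ?I)"
        using assms(9)[OF that] by (simp only: setcompr_eq_image)
      moreover have "?I \<subseteq> {..<m}" using q by auto
      ultimately show ?thesis
        using orth_proj_cols_eq_0_iff[OF PA, of ?I b] \<open>b \<in> carrier_vec m\<close> by auto
    qed
    then show ?thesis unfolding J_def by auto
  qed
  \<comment> \<open>The nodes are squares of the values \<open>c i\<close>; squaring is injective on
    the positive \<open>d j\<close>, so that distinct values stay distinct nodes.\<close>
  have "bij_betw (\<lambda>j. (d j)\<^sup>2) J {(c i)\<^sup>2 | i. i < ?q \<and> ?y $ i \<noteq> 0}"
  proof (rule bij_betw_imageI)
    show "inj_on (\<lambda>j. (d j)\<^sup>2) J"
    proof (rule inj_onI)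
      fix j j' assume *: "j \<in> J" "j' \<in> J" "(d j)\<^sup>2 = (d j')\<^sup>2"
      then have J: "j \<in> {1..l}" "j' \<in> {1..l}" unfolding J_def by blast+
      have "d j = d j'" using *(3) d_pos[OF J(1)] d_pos[OF J(2)] by (simp add: power2_eq_iff_nonneg)
      then show "j = j'" using inj_onD[OF d(1)] J by blast
    qed
    show "(\<lambda>j. (d j)\<^sup>2) ` J = {(c i)\<^sup>2 | i. i < ?q \<and> ?y $ i \<noteq> 0}"
    proof (intro equalityI subsetI)
      fix t assume "t \<in> {(c i)\<^sup>2 | i. i < ?q \<and> ?y $ i \<noteq> 0}"
      then obtain i where i: "t = (c i)\<^sup>2" "i < ?q" "?y $ i \<noteq> 0" by auto
      then have "c i \<in> d ` {1..l}" unfolding d(2) by blast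
      then obtain j where j: "j \<in> {1..l}" "d j = c i" by auto
      then have "j \<in> J" unfolding J using i by auto
      then show "t \<in> (\<lambda>j. (d j)\<^sup>2) ` J" using i j by (intro image_eqI[of _ _ j]) simp_all
    next
      fix t assume "t \<in> (\<lambda>j. (d j)\<^sup>2) ` J"
      then show "t \<in> {(c i)\<^sup>2 | i. i < ?q \<and> ?y $ i \<noteq> 0}" unfolding J by force
    qed
  qed
  then have "card J = card {(c i)\<^sup>2 | i. i < ?q \<and> ?y $ i \<noteq> 0}" by (rule bij_betw_same_card)
  also have "{(c i)\<^sup>2 | i. i < ?q \<and> ?y $ i \<noteq> 0} =
      {(if i < ?q then c i else 0)\<^sup>2 | i. i < ?q \<and> (if i < ?q then c i else 0) \<noteq> 0 \<and> ?y $ i \<noteq> 0}"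
  proof -
    have "i < ?q \<and> ?y $ i \<noteq> 0 \<and> c i \<noteq> 0 \<longleftrightarrow> i < ?q \<and> ?y $ i \<noteq> 0" for i
      using c_pos[of i] by auto
    then show ?thesis by (intro Collect_cong ex_cong1) auto
  qed
  finally show ?thesis
    using diagonalized_gkb.Least_ggkb_breakdown[OF dg i0(2,1)] unfolding J_def by simp
qed

end
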